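(* For every dataset with $n$ points and $p\ge n-1$ variables, given by an $n\times p$ real data matrix $X$ whose rows are in general position, and every non-singular two-dimensional arrangement of $n$ points, given by an $n\times 2$ real matrix $Y$, it is always possible to find (explicitly) an orthogonal projection of $X$ which is "similar" to $Y$. More precisely, given $X$ and $Y$, there is a $p\times 2$ real matrix $Q$ whose columns are orthonormal vectors such that $XQ=Y^\ast$, where $Y^\ast$ is an affine transformation of $Y$, that is, $$Y^\ast = YA+\mathbf{1}b^T$$ for some non-singular $2\times 2$ real matrix $A$ and some vector $b\in\mathbb{R}^2$, where $\mathbf{1}\in\mathbb{R}^n$ is the vector with all entries equal to $1$.
   Context: The rows of an $n\times p$ data matrix $X$ are points of $\mathbb{R}^p$; they are said to be in general position if $X$ has maximal rank, that is, $\operatorname{rank}(X)=\min(p,n)$. An $n\times 2$ matrix $Y$ with rows $y_1^T,\dots,y_n^T$ is a non-singular two-dimensional arrangement of $n$ points if its $2\times 2$ sample covariance matrix $\frac{1}{n-1}\sum_{i=1}^n (y_i-\bar y)(y_i-\bar y)^T$, with $\bar y=\frac1n\sum_{i=1}^n y_i$, is non-singular.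
   Formalization: When p = n−1 the rows of X are also assumed affinely independent; maximal rank alone is not enough, since rows (0,1), (1,1), (2,1) have rank 2 but are collinear, so no projection is an affine image of a triangle. *)

theory Defs
  imports "HOL-Analysis.Analysis"
begin

definition general_position :: "real^'p^'n \<Rightarrow> bool" where
  "general_position X \<longleftrightarrow> rank X = min CARD('p) CARD('n)"

definition sample_mean :: "real^'p^'n \<Rightarrow> real^'p" where
  "sample_mean Y = (1 / real CARD('n)) *\<^sub>R (\<Sum>i\<in>UNIV. row i Y)"

definition outer :: "real^'m \<Rightarrow> real^'k \<Rightarrow> real^'k^'m" where
  "outer u v = (\<chi> i j. u $ i * v $ j)"

definition sample_covariance :: "real^'p^'n \<Rightarrow> real^'p^'p" where
  "sample_covariance Y = (1 / (real CARD('n) - 1)) *\<^sub>R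
     (\<Sum>i\<in>UNIV. outer (row i Y - sample_mean Y) (row i Y - sample_mean Y))"

(* For a single point the scale factor is 1 / 0 = 0 in HOL, so the arrangement counts as singular. *)
definition nonsingular_arrangement :: "real^2^'n \<Rightarrow> bool" where
  "nonsingular_arrangement Y \<longleftrightarrow> invertible (sample_covariance Y)"

definition orthonormal_columns :: "real^'k^'p \<Rightarrow> bool" where
  "orthonormal_columns Q \<longleftrightarrow>
     (\<forall>i j. column i Q \<bullet> column j Q = (if i = j then 1 else 0))"

(* Maximal linear rank does not suffice when p = n - 1; there the rows must also be affinely
   independent, i.e. aff_dim (rows X) = p, equivalently 1 is not in the column space of X. The three points (0,1), (1,1), (2,1)
   form a matrix of rank 2 but are collinear, and so is every orthogonal projection of them. *)
lemma general_position_not_sufficient: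
  "\<exists>(X::real^2^3) (Y::real^2^3).
     general_position X \<and> nonsingular_arrangement Y \<and>
     \<not> (\<exists>(Q::real^2^2) (A::real^2^2) (b::real^2).
          orthonormal_columns Q \<and> invertible A \<and> X ** Q = Y ** A + outer 1 b)"
proof -
  define X :: "real^2^3" where "X = vector [vector [0,1], vector [1,1], vector [2,1]]"
  define Y :: "real^2^3" where "Y = vector [vector [0,0], vector [1,0], vector [0,1]]"
  define w :: "real^3" where "w = vector [1,-2,1]"
  have inj: "x = 0" if "X *v x = 0" for x
    using that
    by (simp add: X_def vec_eq_iff matrix_vector_mult_def forall_2 forall_3 sum_2)
  have "inj ((*v) X)"
    using inj by (simp add: matrix_left_invertible_ker flip: matrix_left_invertible_injective)
  then have "general_position X"
    using full_rank_injective[of X] by (simp add: general_position_def )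
  moreover have "nonsingular_arrangement Y"
    by (simp add: nonsingular_arrangement_def invertible_det_nz det_2 sample_covariance_def
        sample_mean_def outer_def row_def Y_def sum_3 vec_lambda_beta)
  moreover have False if "invertible A" "X ** Q = Y ** A + outer 1 b"
    for Q A :: "real^2^2" and b :: "real^2"
  proof -
    have "w v* X = 0" "w v* outer 1 b = 0"
      by (simp_all add: w_def X_def outer_def vec_eq_iff vector_matrix_mult_def forall_2 sum_3)
    moreover have "w v* (X ** Q) = w v* (Y ** A) + w v* outer 1 b"
      by (simp add: that(2) vec_eq_iff vector_matrix_mult_def algebra_simps sum.distrib)
    ultimately have "(w v* Y) v* A = 0"
      by (simp flip: vector_matrix_mul_assoc add: matrix_vector_mult_0)
    then have "transpose A *v (w v* Y) = 0"
      by simp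
    moreover have "invertible (transpose A)"
      using that(1) by (simp add: invertible_det_nz)
    ultimately have "w v* Y = 0"
      by (metis invertible_def matrix_left_invertible_ker)
    then show False
      by (simp add: w_def Y_def vec_eq_iff vector_matrix_mult_def forall_2 sum_3)
  qed
  ultimately show ?thesis
    by blast
qed

end

(* If y + c 1 lies in the column space of X for each column y of Y and a suitable scalar c, then
   X B = Y + 1 c^T for some p x 2 matrix B. For p >= n the column space is everything; for p = n - 1
   affine independence of the rows says that the columns of X together with 1 span R^n.
   As the covariance of Y is non-singular, no nonzero combination of the columns of Y is constant,
   so B is injective; orthonormalising its columns amounts to Q = B A with A invertible. *)
theory Submission imports Defs begin

lemma outer_matrix_vector_mult: "outer u w *v x = (w \<bullet> x) *\<^sub>R u"
  by (simp add: outer_def matrix_vector_mult_def vec_eq_iff inner_vec_def sum_distrib_left ac_simps)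

lemma outer_matrix_mult: "outer u w ** A = outer u (transpose A *v w)"
  by (simp add: outer_def matrix_matrix_mult_def matrix_vector_mult_def transpose_def vec_eq_iff
      sum_distrib_left ac_simps)

lemma sum_matrix_vector_mult: "(\<Sum>i\<in>I. A i) *v (x::real^'n) = (\<Sum>i\<in>I. A i *v x)"
  by (induction I rule: infinite_finite_induct) (simp_all add: matrix_vector_mult_add_rdistrib)

text \<open>If every row has inner product \<open>t\<close> with \<open>x\<close>, then so does
  their mean. Each centred row is thus orthogonal to \<open>x\<close>, and each outer product in the
  covariance sum annihilates \<open>x\<close>.\<close>

lemma sample_covariance_vector_mult_eq_0:
  fixes Y :: "real^'p^'n"
  assumes "Y *v x = t *\<^sub>R 1"
  shows "sample_covariance Y *v x = 0"
proof -
  have row: "row i Y \<bullet> x = t" for i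
    using arg_cong[OF assms, of "\<lambda>v. v $ i"]
    by (simp add: matrix_vector_mul_component row_def vec_nth_inverse)
  then have "sample_mean Y \<bullet> x = t"
    by (simp add: sample_mean_def inner_sum_left)
  with row have "(\<Sum>i\<in>UNIV. outer (row i Y - sample_mean Y) (row i Y - sample_mean Y)) *v x = 0"
    by (simp add: sum_matrix_vector_mult outer_matrix_vector_mult inner_diff_left)
  then show ?thesis
    by (simp add: sample_covariance_def flip: scaleR_matrix_vector_assoc)
qed

lemma nonsingular_arrangement_const_imp_0:
  assumes "nonsingular_arrangement Y" "Y *v x = t *\<^sub>R 1"
  shows "x = 0"
  using assms sample_covariance_vector_mult_eq_0[OF assms(2)]
  by (metis nonsingular_arrangement_def invertible_def matrix_left_invertible_ker)

lemma orthonormal_columns_transpose_mult: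
  "orthonormal_columns Q \<longleftrightarrow> transpose Q ** Q = mat 1"
  by (auto simp: orthonormal_columns_def matrix_mult_transpose_dot_column mat_def vec_eq_iff)

text \<open>As \<open>B\<close> is injective, an orthonormal basis of its range has exactly one
  vector per column of \<open>B\<close>. Preimages of these vectors under \<open>B\<close> serve as
  the columns of \<open>A\<close>.\<close>

lemma orthonormalise_columns:
  fixes B :: "real^'k^'p"
  assumes "inj ((*v) B)"
  obtains A :: "real^'k^'k" where "invertible A" "orthonormal_columns (B ** A)"
proof -
  let ?S = "range ((*v) B)"
  have "subspace ?S"
    by (simp add: linear_subspace_image)
  then obtain S where S: "S \<subseteq> ?S" "pairwise orthogonal S" "\<And>x. x \<in> S \<Longrightarrow> norm x = 1"
      "independent S" "card S = dim ?S"
    by (metis orthonormal_basis_subspace)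
  have "dim ?S = CARD('k)"
    using dim_image_eq[of "(*v) B" UNIV] assms by simp
  with S have "\<exists>f. bij_betw f (UNIV :: 'k set) S"
    by (intro finite_same_card_bij) (auto intro: independent_imp_finite)
  then obtain q where q: "bij_betw q (UNIV :: 'k set) S" ..
  then have "\<forall>i. \<exists>a. q i = B *v a"
    using S(1) by (fastforce simp: bij_betw_def)
  then obtain a where a: "q i = B *v a i" for i
    by metis
  \<comment> \<open>The transpose turns the vectors \<open>a i\<close> from rows into
    columns.\<close>
  define A where "A = transpose (\<chi> i. a i)"
  have column: "column i (B ** A) = q i" for i
    by (simp add: a A_def column_def transpose_def matrix_matrix_mult_def matrix_vector_mult_def)
  have "q i \<bullet> q j = (if i = j then 1 else 0)" for i j
  proof (cases "i = j")
    case True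
    have "norm (q i) = 1"
      using q S(3) by (auto simp: bij_betw_def)
    with True show ?thesis
      by (simp add: norm_eq_1)
  next
    case False
    with q have "q i \<noteq> q j" "q i \<in> S" "q j \<in> S"
      by (auto simp: bij_betw_def inj_eq)
    with False S(2) show ?thesis
      by (auto simp: pairwise_def orthogonal_def)
  qed
  then have orth: "orthonormal_columns (B ** A)"
    by (simp add: orthonormal_columns_def column)
  \<comment> \<open>Regrouping the Gram matrix exhibits a left inverse of \<open>A\<close>, which
    suffices since \<open>A\<close> is square.\<close>
  then have "(transpose (B ** A) ** B) ** A = mat 1"
    by (simp add: orthonormal_columns_transpose_mult matrix_mul_assoc)
  then have "invertible A"
    by (metis invertible_left_inverse)
  with orth show thesis
    by (rule that[rotated])
qed

text \<open>The map sending \<open>(v, t)\<close> to \<open>X *v v + t *\<^sub>R 1\<close> is linear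
  between spaces of equal dimension p + 1 = n, so surjectivity follows from a trivial
  kernel.\<close>

lemma affinely_spanning_rows_imp_surj:
  fixes X :: "real^'p^'n"
  assumes "CARD('n) = CARD('p) + 1" "aff_dim (rows X) = int CARD('p)"
  shows "\<exists>v t. X *v v + t *\<^sub>R 1 = y"
proof -
  define f :: "(real^'p) \<times> real \<Rightarrow> real^'n" where "f = (\<lambda>(v, t). X *v v + t *\<^sub>R 1)"
  have "linear f"
    by (rule linearI)
      (auto simp: f_def algebra_simps matrix_vector_mult_scaleR)
  have "v = 0 \<and> t = 0" if "f (v, t) = 0" for v t
  proof -
    have row: "v \<bullet> row i X = - t" for i
      using arg_cong[OF that, of "\<lambda>v. v $ i"]
      by (simp add: f_def matrix_vector_mul_component row_def inner_commute vec_nth_inverse)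
    then have "rows X \<subseteq> {x. v \<bullet> x = - t}"
      by (auto simp: rows_def)
    \<comment> \<open>Otherwise all rows would lie in a hyperplane, of affine dimension p -
      1.\<close>
    then have "v = 0"
      using aff_dim_subset[of "rows X" "{x. v \<bullet> x = - t}"] aff_dim_hyperplane[of v "- t"] assms(2)
      by fastforce
    with row show ?thesis
      by simp
  qed
  then have "inj f"
    unfolding linear_injective_0[OF \<open>linear f\<close>] by (metis prod.collapse zero_prod_def)
  then have "dim (range f) = dim (UNIV :: (real^'n) set)"
    using \<open>linear f\<close> assms(1) dim_image_eq[of f UNIV] by simp
  then have "range f = UNIV"
    using \<open>linear f\<close> by (metis dim_eq_full linear_subspace_image span_eq_iff subspace_UNIV dim_UNIV)
  then have "y \<in> range f"
    by simp
  then show ?thesis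
    by (auto simp: f_def)
qed

lemma matrix_mult_add_rdistrib:
  fixes A :: "'a::semiring_1^'n^'m"
  shows "(A + B) ** C = A ** C + B ** C"
  by (simp add: matrix_matrix_mult_def vec_eq_iff distrib_right sum.distrib)

theorem theorem2:
  fixes X :: "real^'p^'n" and Y :: "real^2^'n"
  assumes "CARD('p) \<ge> CARD('n) - 1"
    and "general_position X"
    and "CARD('p) = CARD('n) - 1 \<Longrightarrow> aff_dim (rows X) = int CARD('p)"
    and "nonsingular_arrangement Y"
  shows "\<exists>(Q::real^2^'p) (A::real^2^2) (b::real^2).
    orthonormal_columns Q \<and> invertible A \<and> X ** Q = Y ** A + outer 1 b"
proof -
  have "\<exists>v t. X *v v = y + t *\<^sub>R 1" for y
  proof (cases "CARD('p) \<ge> CARD('n)")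
    case True
    then have "surj ((*v) X)"
      using assms(2) by (simp add: general_position_def full_rank_surjective)
    then obtain v where "y = X *v v"
      by (rule surjE)
    then have "X *v v = y + 0 *\<^sub>R 1"
      by simp
    then show ?thesis
      by blast
  next
    case False
    with assms(1) have "CARD('n) = CARD('p) + 1"
      by linarith
    with assms(3) obtain v t where "X *v v + t *\<^sub>R 1 = y"
      using affinely_spanning_rows_imp_surj[of X y] by auto
    then have "X *v v = y + (- t) *\<^sub>R 1"
      by (simp add: algebra_simps)
    then show ?thesis
      by blast
  qed
  then obtain v t where vt: "X *v v y = y + t y *\<^sub>R 1" for y
    by metis
  \<comment> \<open>The columns of \<open>B\<close> are the preimages chosen for the columns of
    \<open>Y\<close>; \<open>c\<close> collects the corresponding shifts.\<close>
  define B :: "real^2^'p" where "B = transpose (\<chi> j. v (column j Y))"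
  define c :: "real^2" where "c = (\<chi> j. t (column j Y))"
  have "(X ** B) $ i $ j = (X *v v (column j Y)) $ i" for i j
    by (simp add: B_def transpose_def matrix_matrix_mult_def matrix_vector_mult_def)
  then have XB: "X ** B = Y + outer 1 c"
    by (simp add: vt c_def outer_def column_def vec_eq_iff)
  \<comment> \<open>A kernel vector of \<open>B\<close> makes \<open>Y *v x\<close> a multiple of
    \<open>1\<close>, which the non-singular covariance permits only for
    \<open>x = 0\<close>.\<close>
  have "x = 0" if "B *v x = 0" for x
  proof -
    have "Y *v x + (c \<bullet> x) *\<^sub>R 1 = (X ** B) *v x"
      by (simp add: XB matrix_vector_mult_add_rdistrib outer_matrix_vector_mult)
    also have "\<dots> = 0"
      using that by (simp flip: matrix_vector_mul_assoc)
    finally have "Y *v x = (- (c \<bullet> x)) *\<^sub>R 1"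
      by (simp add: eq_neg_iff_add_eq_0)
    with assms(4) show ?thesis
      by (rule nonsingular_arrangement_const_imp_0)
  qed
  then have "inj ((*v) B)"
    by (simp add: linear_injective_0)
  then obtain A :: "real^2^2" where A: "invertible A" "orthonormal_columns (B ** A)"
    by (rule orthonormalise_columns)
  \<comment> \<open>Multiplying the shift term by \<open>A\<close> on the right yields the
    translation vector \<open>b = transpose A *v c\<close>.\<close>
  moreover have "X ** (B ** A) = Y ** A + outer 1 (transpose A *v c)"
    by (simp add: matrix_mul_assoc XB matrix_mult_add_rdistrib outer_matrix_mult)
  ultimately show ?thesis
    by blast
qed

end
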